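(* Let $G$ be a locally compact second countable group, and let $\mathcal{F}_{\ell_{\infty}}(G)$ be the set of all real $p\geq 1$ such that $G$ has property $(F_{\ell_p})$, i.e. such that every action of $G$ by affine isometries on $\ell_p$ admits a fixed point. Then one of the following equalities holds: - $\mathcal{F}_{\ell_{\infty}}(G)=\emptyset$; - $\mathcal{F}_{\ell_{\infty}}(G)=[1,p_c)$ for some $1<p_c\leq\infty$; - $\mathcal{F}_{\ell_{\infty}}(G)=[1,p_c]$ for some $1\leq p_c<\infty$; - $\mathcal{F}_{\ell_{\infty}}(G)=[1,p_c)\setminus\{2\}$ for some $2<p_c\leq\infty$; - $\mathcal{F}_{\ell_{\infty}}(G)=[1,p_c]\setminus\{2\}$ for some $2<p_c<\infty$.
   Context: $\ell_p$ ($1\le p<\infty$) is the complex Banach space of $p$-summable infinite (countably indexed) sequences of complex numbers with the $p$-norm. $O(\ell_p)$ is the group of bijective ($\mathbb{C}$-)linear isometries of $\ell_p$. An orthogonal representation of $G$ on $\ell_p$ is a homomorphism $\pi:G\to O(\ell_p)$ such that $g\mapsto \pi(g)f$ is continuous for every $f\in\ell_p$. An action by affine isometries of $G$ on $\ell_p$ is of the form $\alpha(g)f=\pi(g)f+b(g)$, where $\pi$ is an orthogonal representation and $b:G\to\ell_p$ is a continuous map with $b(gh)=b(g)+\pi(g)b(h)$ for all $g,h\in G$ (a 1-cocycle). Property $(F_{\ell_p})$ means that every such action has a fixed point, i.e. for every orthogonal representation $\pi$ on $\ell_p$, every 1-cocycle $b$ is of the form $b(g)=f-\pi(g)f$ for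 some $f\in \ell_p$. *)

theory Defs
  imports "HOL-Analysis.Analysis"
begin

text \<open>
  Groups are written additively, in the (not necessarily commutative) type class
  \<open>topological_group_add\<close>.  The space \<open>\<ell>\<^sub>p\<close> is a subset of \<open>nat \<Rightarrow> complex\<close>, since the exponent
  is a variable; maps on \<open>\<ell>\<^sub>p\<close> are therefore total functions whose values outside
  \<open>lp p\<close> are never constrained.  Everything is meant for exponents \<open>p \<ge> 1\<close>.
\<close>

definition lp :: "real \<Rightarrow> (nat \<Rightarrow> complex) set" where
  "lp p = {f. summable (\<lambda>n. norm (f n) powr p)}"

definition lp_norm :: "real \<Rightarrow> (nat \<Rightarrow> complex) \<Rightarrow> real" where
  "lp_norm p f = (\<Sum>n. norm (f n) powr p) powr (1 / p)"

definition lp_continuous :: "real \<Rightarrow> ('g::topological_space \<Rightarrow> nat \<Rightarrow> complex) \<Rightarrow> bool" where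
  "lp_continuous p F \<longleftrightarrow>
     (\<forall>g\<^sub>0. ((\<lambda>g. lp_norm p (\<lambda>n. F g n - F g\<^sub>0 n)) \<longlongrightarrow> 0) (at g\<^sub>0))"

text \<open>The group \<open>O(\<ell>\<^sub>p)\<close>.\<close>

definition lp_isometry :: "real \<Rightarrow> ((nat \<Rightarrow> complex) \<Rightarrow> nat \<Rightarrow> complex) \<Rightarrow> bool" where
  "lp_isometry p U \<longleftrightarrow>
     bij_betw U (lp p) (lp p) \<and>
     (\<forall>f\<in>lp p. \<forall>h\<in>lp p. U (\<lambda>n. f n + h n) = (\<lambda>n. U f n + U h n)) \<and>
     (\<forall>c. \<forall>f\<in>lp p. U (\<lambda>n. c * f n) = (\<lambda>n. c * U f n)) \<and>
     (\<forall>f\<in>lp p. lp_norm p (U f) = lp_norm p f)"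

definition orthogonal_rep ::
    "real \<Rightarrow> ('g::topological_group_add \<Rightarrow> (nat \<Rightarrow> complex) \<Rightarrow> nat \<Rightarrow> complex) \<Rightarrow> bool" where
  "orthogonal_rep p \<pi> \<longleftrightarrow>
     (\<forall>g. lp_isometry p (\<pi> g)) \<and>
     (\<forall>g h. \<forall>f\<in>lp p. \<pi> (g + h) f = \<pi> g (\<pi> h f)) \<and>
     (\<forall>f\<in>lp p. lp_continuous p (\<lambda>g. \<pi> g f))"

definition lp_cocycle ::
    "real \<Rightarrow> ('g::topological_group_add \<Rightarrow> (nat \<Rightarrow> complex) \<Rightarrow> nat \<Rightarrow> complex)
      \<Rightarrow> ('g \<Rightarrow> nat \<Rightarrow> complex) \<Rightarrow> bool" where
  "lp_cocycle p \<pi> b \<longleftrightarrow>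
     (\<forall>g. b g \<in> lp p) \<and>
     lp_continuous p b \<and>
     (\<forall>g h. b (g + h) = (\<lambda>n. b g n + \<pi> g (b h) n))"

definition affine_isometric_action ::
    "real \<Rightarrow> ('g::topological_group_add \<Rightarrow> (nat \<Rightarrow> complex) \<Rightarrow> nat \<Rightarrow> complex) \<Rightarrow> bool" where
  "affine_isometric_action p \<alpha> \<longleftrightarrow>
     (\<exists>\<pi> b. orthogonal_rep p \<pi> \<and> lp_cocycle p \<pi> b \<and>
            (\<forall>g. \<forall>f\<in>lp p. \<alpha> g f = (\<lambda>n. \<pi> g f n + b g n)))"

definition property_F_lp :: "'g::topological_group_add itself \<Rightarrow> real \<Rightarrow> bool" where
  "property_F_lp G p \<longleftrightarrow>
     (\<forall>\<alpha> :: 'g \<Rightarrow> (nat \<Rightarrow> complex) \<Rightarrow> nat \<Rightarrow> complex.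
        affine_isometric_action p \<alpha> \<longrightarrow> (\<exists>f\<in>lp p. \<forall>g. \<alpha> g f = f))"

definition F_lp_exponents :: "'g::topological_group_add itself \<Rightarrow> real set" where
  "F_lp_exponents G = {p. 1 \<le> p \<and> property_F_lp G p}"

end

theory Submission
  imports Defs
begin

text \<open>
  The theorem follows from one implication: if \<open>G\<close> has the fixed point property for \<open>p\<close>, and
  \<open>1 \<le> q < p\<close> with \<open>q \<noteq> 2\<close>, then \<open>G\<close> has it for \<open>q\<close> (\<open>property_F_lp_decreasing\<close>).  A set of
  exponents \<open>\<ge> 1\<close> that is closed downwards except possibly at 2 has one of the five listed shapes
  (\<open>decreasing_off_point_cases\<close>); the last two occur when 2 is missing although a larger exponent
  is present.

  The exponent 2 is exceptional because of the Banach--Lamperti theorem (\<open>banach_lamperti\<close>): for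
  \<open>q \<noteq> 2\<close> every surjective linear isometry of \<open>\<ell>\<^sub>q\<close> permutes the coordinates and multiplies them by
  numbers of modulus 1.  Such a monomial formula makes sense for every exponent.  So an orthogonal
  representation \<open>\<pi>\<close> on \<open>\<ell>\<^sub>q\<close> also acts on \<open>\<ell>\<^sub>p\<close>, and a cocycle \<open>b\<close> with values in \<open>\<ell>\<^sub>q \<subseteq> \<ell>\<^sub>p\<close> is
  \<open>b(g) = f - \<pi>(g) f\<close> for some \<open>f \<in> \<ell>\<^sub>p\<close>.  The difficulty is to find such an \<open>f\<close> in \<open>\<ell>\<^sub>q\<close>.

  The tool is the Mazur map \<open>\<phi>(z) = z |z|\<^sup>\<theta>\<^sup>-\<^sup>1\<close> with \<open>\<theta> = q/p < 1\<close>.  It commutes with monomial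
  operators, satisfies \<open>|\<phi>(z)|\<^sup>p = |z|\<^sup>q\<close>, and is Hoelder continuous of exponent \<open>\<theta>\<close>, so that
  \<open>|\<phi>(z) - \<phi>(w)|\<^sup>p\<close> is bounded by a multiple of \<open>|z - w|\<^sup>q\<close>.  Consequently
  \<open>B(g) = \<phi>(f) - \<pi>(g) \<phi>(f)\<close> is an \<open>\<ell>\<^sub>p\<close>-cocycle, although \<open>\<phi>(f)\<close> is not known to lie in \<open>\<ell>\<^sub>p\<close>, and
  the fixed point property for \<open>p\<close>, used a second time, gives \<open>h \<in> \<ell>\<^sub>p\<close> for which
  \<open>k = \<phi>(f) - h\<close> is \<open>\<pi>\<close>-invariant.  If \<open>k \<in> \<ell>\<^sub>p\<close>, then \<open>\<phi>(f) \<in> \<ell>\<^sub>p\<close>, that is, \<open>f \<in> \<ell>\<^sub>q\<close>.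

  The modulus of \<open>k\<close> is constant on the orbits of the permutation action.  On an infinite orbit
  \<open>k = 0\<close>, because \<open>\<phi>(f)\<close> and \<open>h\<close> tend to 0.  On a finite orbit the invariants form a space of
  dimension at most 1, spanned by a unimodular \<open>u\<close>, and \<open>f\<close> may be changed by a multiple of \<open>u\<close>
  without changing the cocycle.  It is normalised so that the real and imaginary parts of
  \<open>cnj u * f\<close> have median 0 on the orbit.  The Mazur map multiplies each entry by a nonnegative
  number, so the parts of \<open>cnj u * \<phi>(f)\<close> have median 0 as well.  The real part of the constant
  \<open>cnj u * k\<close> therefore differs from that of \<open>cnj u * \<phi>(f)\<close> by at least its own modulus on half of
  the orbit, and so does the imaginary part.  It follows that the sum of \<open>|k|\<^sup>p\<close> over the orbit is at
  most a fixed multiple of the sum of \<open>|h|\<^sup>p\<close> (\<open>balanced_translate_exists\<close>).  Hence \<open>k \<in> \<ell>\<^sub>p\<close>.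
\<close>

section \<open>The Mazur map\<close>

definition mazur :: "real \<Rightarrow> complex \<Rightarrow> complex" where
  "mazur \<theta> z = of_real (norm z powr (\<theta> - 1)) * z"

lemma norm_mazur: "norm (mazur \<theta> z) = norm z powr \<theta>"
proof (cases "z = 0")
  case False
  then have "norm z powr (\<theta> - 1) * norm z = norm z powr \<theta>"
    using powr_mult_base[of "norm z" "\<theta> - 1"] by (simp add: mult.commute)
  then show ?thesis by (simp add: mazur_def norm_mult)
qed (simp add: mazur_def)

lemma mazur_unimodular: "norm c = 1 \<Longrightarrow> mazur \<theta> (c * z) = c * mazur \<theta> z"
  by (simp add: mazur_def norm_mult)

lemma mazur_mazur_inverse:
  assumes "\<theta> \<noteq> 0"
  shows "mazur \<theta> (mazur (1 / \<theta>) z) = z"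
proof (cases "z = 0")
  case False
  have "norm (mazur (1 / \<theta>) z) powr (\<theta> - 1) * norm z powr (1 / \<theta> - 1) = 1"
    using False assms
    by (simp add: norm_mazur powr_powr powr_add[symmetric] field_simps)
  then have "complex_of_real (norm (mazur (1 / \<theta>) z) powr (\<theta> - 1)) * complex_of_real (norm z powr (1 / \<theta> - 1)) = 1"
    by (metis of_real_1 of_real_mult)
  then show ?thesis
    by (simp add: mazur_def[of \<theta>]) (simp add: mazur_def mult.assoc[symmetric])
qed (simp add: mazur_def)

lemma powr_minus_one_mult: "0 \<le> (t::real) \<Longrightarrow> t powr (\<theta> - 1) * t = t powr \<theta>"
  by (cases "t = 0") (use powr_mult_base[of t "\<theta> - 1"] in \<open>simp_all add: mult.commute\<close>)

text \<open>
  With \<open>|z| \<le> |w|\<close>, split \<open>\<phi>(z) - \<phi>(w)\<close> into \<open>|w|\<^sup>\<theta>\<^sup>-\<^sup>1 (z - w)\<close> and a multiple of \<open>z\<close>.  As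
  \<open>\<theta> - 1 < 0\<close>, the first term is controlled by \<open>|z - w| \<le> 2 |w|\<close> and the second by
  \<open>|w| - |z| \<le> |w|\<close>.
\<close>

lemma mazur_holder:
  assumes \<theta>: "0 < \<theta>" "\<theta> < 1"
  shows "norm (mazur \<theta> z - mazur \<theta> w) \<le> 3 * norm (z - w) powr \<theta>"
proof (induction "norm z" "norm w" arbitrary: z w rule: linorder_wlog)
  case sym
  then show ?case by (metis norm_minus_commute)
next
  case le
  show ?case
  proof (cases "z = w \<or> z = 0")
    case True
    then show ?thesis by (auto simp: norm_mazur mazur_def[of _ 0])
  next
    case False
    define a b d where "a = norm z" and "b = norm w" and "d = norm (z - w)"
    have pos: "0 < a" "0 < d" "a \<le> b" "0 < b" using False le by (auto simp: a_def b_def d_def)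
    have d: "d \<le> 2 * b" "b - a \<le> d"
      using norm_triangle_ineq4[of z w] norm_triangle_ineq2[of w z] pos
      by (auto simp: a_def b_def d_def norm_minus_commute)
    have eq: "mazur \<theta> z - mazur \<theta> w =
        of_real (b powr (\<theta> - 1)) * (z - w) + of_real (a powr (\<theta> - 1) - b powr (\<theta> - 1)) * z"
      by (simp add: mazur_def a_def b_def algebra_simps)
    \<comment> \<open>The constant 2 comes from \<open>2\<^sup>1\<^sup>-\<^sup>\<theta> \<le> 2\<close>.\<close>
    have 1: "b powr (\<theta> - 1) * d \<le> 2 * d powr \<theta>"
    proof -
      have "b powr (\<theta> - 1) \<le> (d / 2) powr (\<theta> - 1)"
        using pos d \<theta> by (intro powr_mono2') auto
      also have "\<dots> = 2 powr (1 - \<theta>) * d powr (\<theta> - 1)"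
        using pos by (simp add: powr_divide powr_minus_divide[symmetric] powr_diff field_simps)
      also have "\<dots> \<le> 2 * d powr (\<theta> - 1)"
        using powr_mono[of "1 - \<theta>" 1 2] \<theta> by (intro mult_right_mono) auto
      finally have "b powr (\<theta> - 1) * d \<le> 2 * d powr (\<theta> - 1) * d"
        using pos by (intro mult_right_mono) auto
      then show ?thesis using pos powr_minus_one_mult[of d \<theta>] by (simp add: mult.assoc)
    qed
    have mono: "b powr (\<theta> - 1) \<le> a powr (\<theta> - 1)"
      using pos \<theta> by (intro powr_mono2') auto
    have 2: "(a powr (\<theta> - 1) - b powr (\<theta> - 1)) * a \<le> d powr \<theta>"
    proof (cases "a = b")
      case False
      have "(a powr (\<theta> - 1) - b powr (\<theta> - 1)) * a = a powr \<theta> - b powr (\<theta> - 1) * a"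
        using pos by (simp add: left_diff_distrib powr_minus_one_mult)
      also have "\<dots> \<le> b powr \<theta> - b powr (\<theta> - 1) * a"
        using pos \<theta> by (simp add: powr_mono2)
      also have "\<dots> = b powr (\<theta> - 1) * (b - a)"
        using pos by (simp add: right_diff_distrib powr_minus_one_mult)
      also have "\<dots> \<le> (b - a) powr (\<theta> - 1) * (b - a)"
        using pos \<theta> False by (intro mult_right_mono powr_mono2') auto
      also have "\<dots> = (b - a) powr \<theta>" using pos by (simp add: powr_minus_one_mult)
      also have "\<dots> \<le> d powr \<theta>" using pos d \<theta> by (intro powr_mono2) auto
      finally show ?thesis .
    qed simp
    have "norm (mazur \<theta> z - mazur \<theta> w) \<le>
        b powr (\<theta> - 1) * d + (a powr (\<theta> - 1) - b powr (\<theta> - 1)) * a"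
      unfolding eq
      by (rule order_trans[OF norm_triangle_ineq])
        (use mono in \<open>simp add: norm_mult a_def[symmetric] d_def[symmetric] del: of_real_diff\<close>)
    then show ?thesis using 1 2 by (simp add: d_def)
  qed
qed

lemma mazur_holder_powr:
  assumes "0 < q" "q < p"
  shows "norm (mazur (q / p) z - mazur (q / p) w) powr p \<le> 3 powr p * norm (z - w) powr q"
proof -
  have "norm (mazur (q / p) z - mazur (q / p) w) powr p \<le> (3 * norm (z - w) powr (q / p)) powr p"
    using assms by (intro powr_mono2 mazur_holder) auto
  then show ?thesis using assms by (simp add: powr_mult powr_powr)
qed

section \<open>The sequence spaces\<close>

lemma powr_add_le:
  fixes x y :: real
  assumes "0 \<le> x" "0 \<le> y" "0 \<le> p"
  shows "(x + y) powr p \<le> 2 powr p * (x powr p + y powr p)"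
proof -
  have "(x + y) powr p \<le> (2 * max x y) powr p"
    using assms by (intro powr_mono2) auto
  also have "\<dots> = 2 powr p * max x y powr p"
    using assms by (simp add: powr_mult)
  also have "\<dots> \<le> 2 powr p * (x powr p + y powr p)"
    by (intro mult_left_mono) (auto simp: max_def)
  finally show ?thesis .
qed

lemma lp_add:
  assumes "0 \<le> p" "f \<in> lp p" "h \<in> lp p"
  shows "(\<lambda>n. f n + h n) \<in> lp p"
proof -
  have "summable (\<lambda>n. 2 powr p * (norm (f n) powr p + norm (h n) powr p))"
    using assms by (intro summable_mult summable_add) (auto simp: lp_def)
  then show ?thesis unfolding lp_def mem_Collect_eq
  proof (rule summable_comparison_test'[where N = 0])
    fix n
    have "norm (f n + h n) powr p \<le> (norm (f n) + norm (h n)) powr p"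
      using assms(1) by (intro powr_mono2 norm_triangle_ineq) auto
    also have "\<dots> \<le> 2 powr p * (norm (f n) powr p + norm (h n) powr p)"
      using assms(1) by (intro powr_add_le) auto
    finally show "norm (norm (f n + h n) powr p) \<le> 2 powr p * (norm (f n) powr p + norm (h n) powr p)"
      by simp
  qed
qed

lemma lp_cmult: "f \<in> lp p \<Longrightarrow> (\<lambda>n. c * f n) \<in> lp p"
  by (simp add: lp_def norm_mult powr_mult summable_mult)

lemma lp_diff:
  assumes "0 \<le> p" "f \<in> lp p" "h \<in> lp p"
  shows "(\<lambda>n. f n - h n) \<in> lp p"
  using lp_add[OF assms(1,2) lp_cmult[OF assms(3), of "- 1"]] by simp

lemma lp_finite_support:
  assumes "finite {n. f n \<noteq> 0}"
  shows "f \<in> lp p"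
  unfolding lp_def mem_Collect_eq by (rule summable_finite[OF assms]) auto

lemma lp_norm_powr: "0 < p \<Longrightarrow> f \<in> lp p \<Longrightarrow> lp_norm p f powr p = (\<Sum>n. norm (f n) powr p)"
  by (simp add: lp_norm_def lp_def powr_powr suminf_nonneg)

text \<open>
  The form in which Hoelder estimates for the Mazur map become statements about norms.
\<close>

lemma lp_dominated:
  assumes "0 < p" "0 < q" "x \<in> lp q" "\<And>n. norm (y n) powr p \<le> C * norm (x n) powr q"
  shows "y \<in> lp p" "lp_norm p y \<le> (C * lp_norm q x powr q) powr (1 / p)"
proof -
  have S: "summable (\<lambda>n. C * norm (x n) powr q)"
    using assms by (auto simp: lp_def intro: summable_mult)
  show y: "y \<in> lp p" unfolding lp_def mem_Collect_eq
    by (rule summable_comparison_test'[OF S, of 0]) (use assms(4) in auto)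
  have "(\<Sum>n. norm (y n) powr p) \<le> (\<Sum>n. C * norm (x n) powr q)"
    using y S by (intro suminf_le assms(4)) (auto simp: lp_def)
  also have "\<dots> = C * lp_norm q x powr q"
    using assms by (subst lp_norm_powr) (auto simp: lp_def intro: suminf_mult)
  finally show "lp_norm p y \<le> (C * lp_norm q x powr q) powr (1 / p)"
    unfolding lp_norm_def[of p] using assms(1) y
    by (intro powr_mono2 suminf_nonneg) (auto simp: lp_def)
qed

lemma lp_coordinate_le:
  assumes "0 < p" "f \<in> lp p"
  shows "norm (f n) \<le> lp_norm p f"
proof -
  have "norm (f n) powr p \<le> (\<Sum>n. norm (f n) powr p)"
    using sum_le_suminf[of "\<lambda>n. norm (f n) powr p" "{n}"] assms by (simp add: lp_def)
  then have "(norm (f n) powr p) powr (1 / p) \<le> lp_norm p f"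
    unfolding lp_norm_def using assms by (intro powr_mono2) auto
  then show ?thesis using assms by (simp add: powr_powr)
qed

lemma lp_norm_nonneg: "0 \<le> lp_norm p f"
  by (simp add: lp_norm_def)

lemma lp_subset:
  assumes "0 < q" "q \<le> p" "f \<in> lp q"
  shows "f \<in> lp p" "lp_norm p f \<le> lp_norm q f"
proof -
  define N where "N = lp_norm q f"
  have N: "0 \<le> N" by (simp add: N_def lp_norm_nonneg)
  have *: "norm (f n) powr p \<le> N powr (p - q) * norm (f n) powr q" for n
  proof -
    have "norm (f n) powr p = norm (f n) powr (p - q) * norm (f n) powr q"
      by (simp add: powr_add[symmetric])
    also have "\<dots> \<le> N powr (p - q) * norm (f n) powr q"
      using assms lp_coordinate_le[of q f n] by (intro mult_right_mono powr_mono2) (auto simp: N_def)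
    finally show ?thesis .
  qed
  show "f \<in> lp p" using lp_dominated(1)[OF _ assms(1,3) *] assms by simp
  have "lp_norm p f \<le> (N powr (p - q) * N powr q) powr (1 / p)"
    using lp_dominated(2)[OF _ assms(1,3) *] assms by (simp add: N_def)
  also have "\<dots> = N" using assms N by (simp add: powr_add[symmetric] powr_powr)
  finally show "lp_norm p f \<le> lp_norm q f" by (simp add: N_def)
qed

lemma lp_tendsto_0:
  assumes "0 < p" "f \<in> lp p"
  shows "f \<longlonglongrightarrow> 0"
proof -
  have "(\<lambda>n. norm (f n) powr p) \<longlonglongrightarrow> 0"
    using assms by (intro summable_LIMSEQ_zero) (auto simp: lp_def)
  then have "(\<lambda>n. (norm (f n) powr p) powr (1 / p)) \<longlonglongrightarrow> 0 powr (1 / p)"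
    using assms by (intro tendsto_powr2) auto
  then show ?thesis using assms by (simp add: powr_powr tendsto_norm_zero_iff)
qed

lemma lp_continuous_dominated:
  assumes pq: "0 < p" "0 < q" "0 \<le> C"
    and F: "lp_continuous q F" and "\<And>g g'. (\<lambda>n. F g n - F g' n) \<in> lp q"
    and "\<And>g g' n. norm (H g n - H g' n) powr p \<le> C * norm (F g n - F g' n) powr q"
  shows "lp_continuous p H"
  unfolding lp_continuous_def
proof
  fix g'
  have "((\<lambda>g. (C * lp_norm q (\<lambda>n. F g n - F g' n) powr q) powr (1 / p)) \<longlongrightarrow> (C * 0 powr q) powr (1 / p)) (at g')"
  proof (intro tendsto_powr2 tendsto_mult tendsto_const)
    show "((\<lambda>g. lp_norm q (\<lambda>n. F g n - F g' n)) \<longlongrightarrow> 0) (at g')"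
      using F by (simp add: lp_continuous_def)
  qed (use pq in \<open>auto simp: lp_norm_nonneg\<close>)
  then have lim: "((\<lambda>g. (C * lp_norm q (\<lambda>n. F g n - F g' n) powr q) powr (1 / p)) \<longlongrightarrow> 0) (at g')"
    using pq by simp
  have le: "lp_norm p (\<lambda>n. H g n - H g' n) \<le> (C * lp_norm q (\<lambda>n. F g n - F g' n) powr q) powr (1 / p)" for g
    by (rule lp_dominated(2)[OF pq(1,2) assms(5,6)])
  show "((\<lambda>g. lp_norm p (\<lambda>n. H g n - H g' n)) \<longlongrightarrow> 0) (at g')"
    by (rule tendsto_sandwich[OF _ _ tendsto_const lim]) (simp_all add: le lp_norm_nonneg)
qed

lemma lp_continuous_mono:
  assumes "0 < q" "q \<le> p" and F: "lp_continuous q F" and "\<And>g g'. (\<lambda>n. F g n - F g' n) \<in> lp q"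
  shows "lp_continuous p F"
  unfolding lp_continuous_def
proof
  fix g'
  show "((\<lambda>g. lp_norm p (\<lambda>n. F g n - F g' n)) \<longlongrightarrow> 0) (at g')"
  proof (rule tendsto_sandwich[OF _ _ tendsto_const])
    show "((\<lambda>g. lp_norm q (\<lambda>n. F g n - F g' n)) \<longlongrightarrow> 0) (at g')"
      using F by (simp add: lp_continuous_def)
  qed (use lp_subset(2)[OF assms(1,2,4)] in \<open>simp_all add: lp_norm_nonneg\<close>)
qed

section \<open>Surjective isometries are monomial\<close>

text \<open>
  The defect of the parallelogram law for the exponent \<open>p\<close>.
\<close>

definition clarkson :: "real \<Rightarrow> complex \<Rightarrow> complex \<Rightarrow> real" where
  "clarkson p z w = norm (z + w) powr p + norm (z - w) powr p - 2 * norm z powr p - 2 * norm w powr p"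

lemma powr_superadditive_strict:
  fixes x y r :: real
  assumes "0 < x" "0 < y" "1 < r"
  shows "x powr r + y powr r < (x + y) powr r"
proof -
  have "x * x powr (r - 1) < x * (x + y) powr (r - 1)" "y * y powr (r - 1) < y * (x + y) powr (r - 1)"
    using assms by (auto intro!: mult_strict_left_mono powr_less_mono2)
  then have "x * x powr (r - 1) + y * y powr (r - 1) < (x + y) * (x + y) powr (r - 1)"
    by (simp add: distrib_right)
  then show ?thesis using assms by (simp add: powr_mult_base)
qed

lemma powr_midpoint_convex:
  fixes s t r :: real
  assumes "0 \<le> s" "0 \<le> t" "1 < r"
  shows "((s + t) / 2) powr r \<le> (s powr r + t powr r) / 2"
proof (cases "s = 0 \<or> t = 0")
  case True
  have "(1 / 2 :: real) powr r \<le> (1 / 2) powr 1" using assms by (intro powr_mono') auto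
  then have "(1 / 2) powr r * u powr r \<le> 1 / 2 * u powr r" for u :: real
    by (intro mult_right_mono) auto
  then have "(u / 2) powr r \<le> u powr r / 2" if "0 \<le> u" for u :: real
    using that powr_mult[of "1 / 2" u r] by simp
  then show ?thesis using True assms by auto
next
  case False
  then show ?thesis
    using convex_onD[OF powr_convex[of r], of "1 / 2" s t] assms by (simp add: add_divide_distrib)
qed

text \<open>
  Convexity bounds \<open>s\<^sup>r + t\<^sup>r\<close> by \<open>2 (x + y)\<^sup>r\<close>, and \<open>(x + y)\<^sup>r\<close> is compared with \<open>x\<^sup>r + y\<^sup>r\<close> by
  strict superadditivity.  For \<open>r < 1\<close> both facts are applied to the exponent \<open>1 / r\<close>.
\<close>

lemma powr_strict_jensen:
  fixes s t x y r :: real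
  assumes "0 \<le> s" "0 \<le> t" "0 < x" "0 < y" "s + t = 2 * (x + y)"
  shows "1 < r \<Longrightarrow> 2 * x powr r + 2 * y powr r < s powr r + t powr r"
    and "0 < r \<Longrightarrow> r < 1 \<Longrightarrow> s powr r + t powr r < 2 * x powr r + 2 * y powr r"
proof -
  have st: "(s + t) / 2 = x + y" using assms by simp
  show "2 * x powr r + 2 * y powr r < s powr r + t powr r" if "1 < r"
    using powr_midpoint_convex[OF assms(1,2) that] powr_superadditive_strict[OF assms(3,4) that]
    unfolding st by simp
  assume r: "0 < r" "r < 1"
  have "((s powr r + t powr r) / 2) powr (1 / r) \<le> x + y"
    using powr_midpoint_convex[of "s powr r" "t powr r" "1 / r"] assms r by (simp add: powr_powr)
  also have "\<dots> < (x powr r + y powr r) powr (1 / r)"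
    using powr_superadditive_strict[of "x powr r" "y powr r" "1 / r"] assms r by (simp add: powr_powr)
  finally have "(s powr r + t powr r) / 2 < x powr r + y powr r"
    using powr_mono2[of "1 / r" "x powr r + y powr r" "(s powr r + t powr r) / 2"] r by fastforce
  then show "s powr r + t powr r < 2 * x powr r + 2 * y powr r" by simp
qed

text \<open>
  By the parallelogram law, the squares \<open>s\<close>, \<open>t\<close> of \<open>|z + w|\<close>, \<open>|z - w|\<close> and the squares \<open>x\<close>, \<open>y\<close> of
  \<open>|z|\<close>, \<open>|w|\<close> satisfy \<open>s + t = 2 (x + y)\<close>, so the Jensen-type inequality applies with exponent
  \<open>p / 2\<close>.
\<close>

lemma clarkson_sign:
  assumes "0 < p" "p \<noteq> 2" "z \<noteq> 0" "w \<noteq> 0"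
  shows "0 < (p - 2) * clarkson p z w"
proof -
  have sq: "norm u powr p = (norm u ^ 2) powr (p / 2)" for u :: complex
    by (cases "u = 0") (simp_all add: powr_numeral[symmetric] powr_powr del: powr_numeral)
  have par: "norm (z + w) ^ 2 + norm (z - w) ^ 2 = 2 * (norm z ^ 2 + norm w ^ 2)"
    by (simp add: cmod_power2) (simp add: power2_eq_square algebra_simps)
  show ?thesis
  proof (cases "2 < p")
    case True
    then have "2 * (norm z)\<^sup>2 powr (p / 2) + 2 * (norm w)\<^sup>2 powr (p / 2)
        < (norm (z + w))\<^sup>2 powr (p / 2) + (norm (z - w))\<^sup>2 powr (p / 2)"
      using assms by (intro powr_strict_jensen(1) par) auto
    then show ?thesis using True by (simp add: clarkson_def sq)
  next
    case False
    then have "(norm (z + w))\<^sup>2 powr (p / 2) + (norm (z - w))\<^sup>2 powr (p / 2)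
        < 2 * (norm z)\<^sup>2 powr (p / 2) + 2 * (norm w)\<^sup>2 powr (p / 2)"
      using assms by (intro powr_strict_jensen(2) par) auto
    then show ?thesis using assms False by (simp add: clarkson_def sq mult_neg_neg)
  qed
qed

definition disjoint_support :: "(nat \<Rightarrow> complex) \<Rightarrow> (nat \<Rightarrow> complex) \<Rightarrow> bool" where
  "disjoint_support f h \<longleftrightarrow> (\<forall>n. f n = 0 \<or> h n = 0)"

text \<open>
  Disjointness of supports is visible from norms alone: the Clarkson defects of the coordinates all
  have the same sign, and so they sum to 0 only if each of them vanishes.
\<close>

lemma disjoint_support_iff_norm:
  assumes p: "0 < p" "p \<noteq> 2" and fh: "f \<in> lp p" "h \<in> lp p"
  shows "disjoint_support f h \<longleftrightarrow>
    lp_norm p (\<lambda>n. f n + h n) powr p + lp_norm p (\<lambda>n. f n - h n) powr p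
      = 2 * lp_norm p f powr p + 2 * lp_norm p h powr p"
proof -
  have clark0: "clarkson p z w = 0" if "z = 0 \<or> w = 0" for z w
    using that by (auto simp: clarkson_def)
  have nn: "0 \<le> (p - 2) * clarkson p z w" for z w
    using clarkson_sign[OF p, of z w] clark0[of z w] by fastforce
  have "(p - 2) * clarkson p z w = 0 \<longleftrightarrow> z = 0 \<or> w = 0" for z w
    using clarkson_sign[OF p, of z w] clark0[of z w] by (metis mult_zero_right order_less_irrefl)
  moreover have "(\<lambda>n. clarkson p (f n) (h n)) sums
     (lp_norm p (\<lambda>n. f n + h n) powr p + lp_norm p (\<lambda>n. f n - h n) powr p
        - 2 * lp_norm p f powr p - 2 * lp_norm p h powr p)"
    unfolding clarkson_def using p fh lp_add[OF _ fh] lp_diff[OF _ fh]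
    by (intro sums_add sums_diff sums_mult) (simp_all add: lp_norm_powr, auto simp: lp_def)
  then have S: "(\<lambda>n. (p - 2) * clarkson p (f n) (h n)) sums
     ((p - 2) * (lp_norm p (\<lambda>n. f n + h n) powr p + lp_norm p (\<lambda>n. f n - h n) powr p
        - 2 * lp_norm p f powr p - 2 * lp_norm p h powr p))"
    by (rule sums_mult)
  ultimately show ?thesis
    using suminf_eq_zero_iff[OF sums_summable[OF S] nn] sums_unique[OF S] p
    by (auto simp: disjoint_support_def)
qed

lemma lp_isometry_disjoint_support_iff:
  assumes p: "0 < p" "p \<noteq> 2" and U: "lp_isometry p U" and fh: "f \<in> lp p" "h \<in> lp p"
  shows "disjoint_support (U f) (U h) \<longleftrightarrow> disjoint_support f h"
proof -
  have mem: "U f \<in> lp p" if "f \<in> lp p" for f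
    using U that unfolding lp_isometry_def by (metis bij_betwE)
  have nrm: "lp_norm p (U f) = lp_norm p f" if "f \<in> lp p" for f
    using U that unfolding lp_isometry_def by metis
  have add: "U (\<lambda>n. f n + h n) = (\<lambda>n. U f n + U h n)" if "f \<in> lp p" "h \<in> lp p" for f h
    using U that unfolding lp_isometry_def by metis
  have "U (\<lambda>n. - 1 * h n) = (\<lambda>n. - 1 * U h n)"
    using U fh unfolding lp_isometry_def by metis
  then have diff: "U (\<lambda>n. f n - h n) = (\<lambda>n. U f n - U h n)"
    using add[OF fh(1) lp_cmult[OF fh(2), of "- 1"]] by simp
  have "lp_norm p (\<lambda>n. U f n + U h n) = lp_norm p (\<lambda>n. f n + h n)"
    "lp_norm p (\<lambda>n. U f n - U h n) = lp_norm p (\<lambda>n. f n - h n)"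
    using p fh by (simp_all add: add[symmetric] diff[symmetric] nrm lp_add lp_diff)
  then show ?thesis
    using p fh by (simp add: disjoint_support_iff_norm mem nrm)
qed

definition unit_seq :: "nat \<Rightarrow> nat \<Rightarrow> complex" where
  "unit_seq n = (\<lambda>m. if m = n then 1 else 0)"

lemma unit_seq_lp: "unit_seq n \<in> lp p"
  by (rule lp_finite_support) (simp add: unit_seq_def)

lemma lp_norm_single:
  assumes "0 < p" "\<And>m. m \<noteq> k \<Longrightarrow> f m = 0"
  shows "lp_norm p f = norm (f k)"
proof -
  have "(\<Sum>n. norm (f n) powr p) = (\<Sum>n\<in>{k}. norm (f n) powr p)"
    using assms by (intro suminf_finite) auto
  then show ?thesis using assms by (simp add: lp_norm_def powr_powr)
qed

text \<open>
  An isometry \<open>U\<close> preserves and reflects disjointness of supports.  Therefore the matrix entry of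
  \<open>U\<close> at \<open>(m, n)\<close> vanishes exactly when the entry of the inverse at \<open>(n, m)\<close> does, and the matrix has
  exactly one nonzero entry in each row and each column.  Each coordinate of
  \<open>U f\<close> for general \<open>f\<close> is read off by splitting off one coordinate of \<open>f\<close>.
\<close>

theorem banach_lamperti:
  assumes p: "0 < p" "p \<noteq> 2" and U: "lp_isometry p U"
  obtains c \<sigma> where "bij \<sigma>" "\<And>n. norm (c n) = 1" "\<And>f. f \<in> lp p \<Longrightarrow> U f = (\<lambda>n. c n * f (\<sigma> n))"
proof -
  have bij: "bij_betw U (lp p) (lp p)" using U by (simp add: lp_isometry_def)
  have add: "U (\<lambda>n. f n + h n) = (\<lambda>n. U f n + U h n)" if "f \<in> lp p" "h \<in> lp p" for f h
    using U that unfolding lp_isometry_def by metis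
  have cmult: "U (\<lambda>n. a * f n) = (\<lambda>n. a * U f n)" if "f \<in> lp p" for a f
    using U that unfolding lp_isometry_def by metis
  note dis = lp_isometry_disjoint_support_iff[OF p U]
  have dis_unit: "disjoint_support f (unit_seq n) \<longleftrightarrow> f n = 0" for f n
    by (auto simp: disjoint_support_def unit_seq_def)
  define x where "x m = inv_into (lp p) U (unit_seq m)" for m
  have x: "x m \<in> lp p" "U (x m) = unit_seq m" for m
    using bij bij_betw_inv_into_right[OF bij unit_seq_lp] unit_seq_lp[of m p] inv_into_into[of "unit_seq m" U "lp p"]
    by (auto simp: x_def bij_betw_def)
  define A where "A n = U (unit_seq n)" for n
  \<comment> \<open>Both sides say that \<open>unit_seq n\<close> and \<open>x m\<close> have disjoint supports, before and after applying \<open>U\<close>.\<close>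
  have A_iff: "A n m = 0 \<longleftrightarrow> x m n = 0" for n m
    using dis[OF unit_seq_lp x(1), of n m] dis_unit[of "A n" m] dis_unit[of "x m" n]
    by (auto simp: x A_def disjoint_support_def)
  have norm_A: "lp_norm p (A n) = 1" for n
    using U lp_norm_single[of p n "unit_seq n"] p unfolding lp_isometry_def A_def
    by (simp add: unit_seq_lp) (simp add: unit_seq_def)
  have "\<exists>m. A n m \<noteq> 0" for n
    using norm_A[of n] lp_norm_single[of p 0 "A n"] p by (metis norm_zero zero_neq_one)
  moreover have "m = m'" if "A n m \<noteq> 0" "A n m' \<noteq> 0" for n m m'
  proof -
    have "\<not> disjoint_support (x m) (x m')"
      using that by (auto simp: A_iff disjoint_support_def)
    then have "\<not> disjoint_support (unit_seq m) (unit_seq m')"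
      using dis[OF x(1) x(1), of m m'] by (simp add: x)
    then show ?thesis by (auto simp: dis_unit) (simp add: unit_seq_def split: if_splits)
  qed
  ultimately obtain \<tau> where \<tau>: "\<And>n m. A n m \<noteq> 0 \<longleftrightarrow> m = \<tau> n" by metis
  have "inj \<tau>"
  proof (rule injI)
    fix n n' assume "\<tau> n = \<tau> n'"
    then have "\<not> disjoint_support (A n) (A n')" using \<tau> by (metis disjoint_support_def)
    then show "n = n'"
      using dis[OF unit_seq_lp unit_seq_lp, of n n'] by (auto simp: A_def disjoint_support_def unit_seq_def split: if_splits)
  qed
  moreover have "surj \<tau>"
  proof (rule surjI)
    fix m
    show "\<tau> (SOME n. x m n \<noteq> 0) = m"
    proof -
      have "unit_seq m m \<noteq> 0" by (simp add: unit_seq_def)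
      moreover have "U (\<lambda>n. 0) = (\<lambda>n. 0)" using cmult[OF x(1), of 0 m] by simp
      ultimately have "\<exists>n. x m n \<noteq> 0" using x(2)[of m] by (metis ext)
      then have "x m (SOME n. x m n \<noteq> 0) \<noteq> 0" by (rule someI_ex)
      then show ?thesis using A_iff \<tau> by metis
    qed
  qed
  ultimately have bij_\<tau>: "bij \<tau>" by (simp add: bij_def)
  define \<sigma> where "\<sigma> = inv \<tau>"
  define c where "c m = A (\<sigma> m) m" for m
  have \<tau>\<sigma>: "\<tau> (\<sigma> m) = m" for m using bij_\<tau> by (simp add: \<sigma>_def bij_is_surj surj_f_inv_f)
  show thesis
  proof
    show "bij \<sigma>" using bij_\<tau> by (simp add: \<sigma>_def bij_imp_bij_inv)
    show "norm (c m) = 1" for m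
      using norm_A[of "\<sigma> m"] lp_norm_single[of p m "A (\<sigma> m)"] \<tau> \<tau>\<sigma> p by (metis c_def)
    show "U f = (\<lambda>n. c n * f (\<sigma> n))" if f: "f \<in> lp p" for f
    proof
      fix m
      define n where "n = \<sigma> m"
      \<comment> \<open>\<open>f'\<close> is disjoint from \<open>unit_seq n\<close>, so \<open>U f'\<close> vanishes where \<open>A n\<close> does not.\<close>
      define f' where "f' = (\<lambda>k. f k - f n * unit_seq n k)"
      have f': "f' \<in> lp p" using p f by (auto simp: f'_def intro!: lp_diff lp_cmult unit_seq_lp)
      have "f = (\<lambda>k. f' k + f n * unit_seq n k)" by (simp add: f'_def)
      then have "U f = (\<lambda>k. U f' k + f n * A n k)"
        using add[OF f' lp_cmult[OF unit_seq_lp], of "f n" n] by (simp add: cmult[OF unit_seq_lp] A_def)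
      moreover have "disjoint_support (U f') (A n)"
        unfolding A_def dis[OF f' unit_seq_lp] dis_unit by (simp add: f'_def unit_seq_def)
      then have "U f' m = 0" using \<tau> \<tau>\<sigma> by (metis n_def disjoint_support_def)
      ultimately show "U f m = c m * f (\<sigma> m)" by (simp add: c_def n_def)
    qed
  qed
qed

lemma lp_bij_reindex:
  assumes "bij \<sigma>" "f \<in> lp p" "\<And>n. norm (g n) = norm (f (\<sigma> n))"
  shows "g \<in> lp p" "lp_norm p g = lp_norm p f"
proof -
  let ?F = "\<lambda>n. norm (f n) powr p"
  have eq: "(\<lambda>n. norm (g n) powr p) = ?F \<circ> \<sigma>" by (simp add: assms(3) fun_eq_iff)
  have inj: "inj \<sigma>" "surj \<sigma>" using assms(1) by (auto simp: bij_def)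
  have F: "summable ?F" using assms(2) by (simp add: lp_def)
  show "g \<in> lp p" using summable_reindex[OF F inj(1)] eq by (simp add: lp_def)
  show "lp_norm p g = lp_norm p f"
    unfolding lp_norm_def eq using suminf_reindex[OF F inj(1)] inj(2) by simp
qed

lemma lp_isometry_monomial:
  assumes \<sigma>: "bij \<sigma>" and c: "\<And>n. norm (c n) = 1"
  shows "lp_isometry p (\<lambda>f n. c n * f (\<sigma> n))"
proof -
  have inv: "\<sigma> (inv \<sigma> n) = n" "inv \<sigma> (\<sigma> n) = n" for n
    using \<sigma> by (auto simp: bij_is_surj surj_f_inv_f bij_is_inj)
  have cc: "c n * (cnj (c n) * z) = z" "cnj (c n) * (c n * z) = z" for n z
  proof -
    have "c n * cnj (c n) = 1" using c[of n] complex_norm_square[of "c n"] by simp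
    then show "c n * (cnj (c n) * z) = z" "cnj (c n) * (c n * z) = z"
      by (metis mult.assoc mult.commute mult_1)+
  qed
  have "bij_betw (\<lambda>f n. c n * f (\<sigma> n)) (lp p) (lp p)"
  proof (rule bij_betwI[where g = "\<lambda>f n. cnj (c (inv \<sigma> n)) * f (inv \<sigma> n)"])
    show "(\<lambda>f n. c n * f (\<sigma> n)) \<in> lp p \<rightarrow> lp p"
    proof
      fix f assume "f \<in> lp p"
      then show "(\<lambda>n. c n * f (\<sigma> n)) \<in> lp p"
        by (rule lp_bij_reindex(1)[OF \<sigma>]) (simp add: norm_mult c)
    qed
    show "(\<lambda>f n. cnj (c (inv \<sigma> n)) * f (inv \<sigma> n)) \<in> lp p \<rightarrow> lp p"
    proof
      fix f assume "f \<in> lp p"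
      then show "(\<lambda>n. cnj (c (inv \<sigma> n)) * f (inv \<sigma> n)) \<in> lp p"
        by (rule lp_bij_reindex(1)[OF bij_imp_bij_inv[OF \<sigma>]]) (simp add: norm_mult c)
    qed
  qed (simp_all add: inv cc)
  moreover have "lp_norm p (\<lambda>n. c n * f (\<sigma> n)) = lp_norm p f" if "f \<in> lp p" for f
    using that by (rule lp_bij_reindex(2)[OF \<sigma>]) (simp add: norm_mult c)
  ultimately show ?thesis
    by (simp add: lp_isometry_def algebra_simps)
qed

section \<open>Medians\<close>

text \<open>
  The least value \<open>t\<close> of \<open>x\<close> for which at least half of the indices satisfy \<open>x n \<le> t\<close>: the values below
  \<open>t\<close> then make up at most half.
\<close>

lemma median_exists:
  fixes x :: "'a \<Rightarrow> real"
  assumes fin: "finite I" and ne: "I \<noteq> {}"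
  obtains t where "card I \<le> 2 * card {n\<in>I. x n \<le> t}" "card I \<le> 2 * card {n\<in>I. t \<le> x n}"
proof -
  define T where "T = {t \<in> x ` I. card I \<le> 2 * card {n\<in>I. x n \<le> t}}"
  have "{n\<in>I. x n \<le> Max (x ` I)} = I" using fin by auto
  then have "Max (x ` I) \<in> T" using fin ne by (auto simp: T_def)
  then have T: "finite T" "T \<noteq> {}" using fin by (auto simp: T_def)
  define t where "t = Min T"
  have t: "t \<in> T" using T by (auto simp: t_def)
  have low: "2 * card {n\<in>I. x n < t} \<le> card I"
  proof (cases "{n\<in>I. x n < t} = {}")
    case False
    define s where "s = Max (x ` {n\<in>I. x n < t})"
    have s: "s \<in> x ` {n\<in>I. x n < t}" using False fin by (auto simp: s_def intro: Max_in)
    then have "s \<notin> T" using T by (auto simp: t_def)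
    moreover have "card {n\<in>I. x n < t} \<le> card {n\<in>I. x n \<le> s}"
      using fin by (intro card_mono) (auto simp: s_def)
    ultimately show ?thesis using s by (auto simp: T_def)
  qed (simp only: card.empty)
  have "{n\<in>I. t \<le> x n} = I - {n\<in>I. x n < t}" by auto
  then have "card {n\<in>I. t \<le> x n} = card I - card {n\<in>I. x n < t}"
    using fin by (simp add: card_Diff_subset)
  then show thesis using low t by (intro that[of t]) (auto simp: T_def)
qed

lemma card_times_le_sum:
  fixes y :: "'a \<Rightarrow> real" and e :: real
  assumes "finite I" "A \<subseteq> I" "card I \<le> 2 * card A"
    and "\<And>n. n \<in> A \<Longrightarrow> e \<le> y n" "\<And>n. n \<in> I \<Longrightarrow> 0 \<le> y n" "0 \<le> e"
  shows "card I * e \<le> 2 * (\<Sum>n\<in>I. y n)"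
proof -
  have "card I * e \<le> (2 * card A) * e" using assms by (intro mult_right_mono) linarith+
  also have "\<dots> = 2 * (\<Sum>n\<in>A. e)" by simp
  also have "(\<Sum>n\<in>A. e) \<le> (\<Sum>n\<in>A. y n)" using assms by (intro sum_mono) auto
  also have "\<dots> \<le> (\<Sum>n\<in>I. y n)" using assms by (intro sum_mono2) auto
  finally show ?thesis by simp
qed

text \<open>
  If \<open>e \<ge> 0\<close>, then \<open>|y n - e| \<ge> e\<close> wherever \<open>x n \<le> 0\<close>, which is at least half of the index set;
  the other sign is symmetric.
\<close>

lemma median_zero_bound:
  fixes x y :: "'a \<Rightarrow> real"
  assumes fin: "finite I" and p: "0 \<le> p"
    and sgn: "\<And>n. n \<in> I \<Longrightarrow> 0 \<le> x n \<Longrightarrow> 0 \<le> y n" "\<And>n. n \<in> I \<Longrightarrow> x n \<le> 0 \<Longrightarrow> y n \<le> 0"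
    and med: "card I \<le> 2 * card {n\<in>I. x n \<le> 0}" "card I \<le> 2 * card {n\<in>I. 0 \<le> x n}"
  shows "card I * \<bar>e\<bar> powr p \<le> 2 * (\<Sum>n\<in>I. \<bar>y n - e\<bar> powr p)"
proof (cases "0 \<le> e")
  case True
  show ?thesis
  proof (rule card_times_le_sum[OF fin _ med(1)])
    fix n assume "n \<in> {n\<in>I. x n \<le> 0}"
    then have "\<bar>e\<bar> \<le> \<bar>y n - e\<bar>" using sgn(2)[of n] True by simp
    then show "\<bar>e\<bar> powr p \<le> \<bar>y n - e\<bar> powr p" using p by (intro powr_mono2) auto
  qed auto
next
  case False
  show ?thesis
  proof (rule card_times_le_sum[OF fin _ med(2)])
    fix n assume "n \<in> {n\<in>I. 0 \<le> x n}"
    then have "\<bar>e\<bar> \<le> \<bar>y n - e\<bar>" using sgn(1)[of n] False by simp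
    then show "\<bar>e\<bar> powr p \<le> \<bar>y n - e\<bar> powr p" using p by (intro powr_mono2) auto
  qed auto
qed

lemma complex_median_zero_bound:
  fixes x y :: "'a \<Rightarrow> complex"
  assumes fin: "finite I" and p: "0 \<le> p"
    and y: "\<And>n. n \<in> I \<Longrightarrow> y n = of_real (s n) * x n" "\<And>n. 0 \<le> s n"
    and Re: "card I \<le> 2 * card {n\<in>I. Re (x n) \<le> 0}" "card I \<le> 2 * card {n\<in>I. 0 \<le> Re (x n)}"
    and Im: "card I \<le> 2 * card {n\<in>I. Im (x n) \<le> 0}" "card I \<le> 2 * card {n\<in>I. 0 \<le> Im (x n)}"
  shows "card I * norm e powr p \<le> 4 * 2 powr p * (\<Sum>n\<in>I. norm (y n - e) powr p)"
proof -
  let ?S = "\<Sum>n\<in>I. norm (y n - e) powr p"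
  have "card I * \<bar>Re e\<bar> powr p \<le> 2 * (\<Sum>n\<in>I. \<bar>Re (y n) - Re e\<bar> powr p)"
    using y by (intro median_zero_bound[OF fin p _ _ Re]) (auto simp: mult_nonneg_nonpos)
  also have "(\<Sum>n\<in>I. \<bar>Re (y n) - Re e\<bar> powr p) \<le> ?S"
    using p abs_Re_le_cmod[of "y _ - e"] by (intro sum_mono powr_mono2) auto
  finally have 1: "card I * \<bar>Re e\<bar> powr p \<le> 2 * ?S" by simp
  have "card I * \<bar>Im e\<bar> powr p \<le> 2 * (\<Sum>n\<in>I. \<bar>Im (y n) - Im e\<bar> powr p)"
    using y by (intro median_zero_bound[OF fin p _ _ Im]) (auto simp: mult_nonneg_nonpos)
  also have "(\<Sum>n\<in>I. \<bar>Im (y n) - Im e\<bar> powr p) \<le> ?S"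
    using p abs_Im_le_cmod[of "y _ - e"] by (intro sum_mono powr_mono2) auto
  finally have 2: "card I * \<bar>Im e\<bar> powr p \<le> 2 * ?S" by simp
  have "norm e powr p \<le> (\<bar>Re e\<bar> + \<bar>Im e\<bar>) powr p"
    using p by (intro powr_mono2 cmod_le) auto
  also have "\<dots> \<le> 2 powr p * (\<bar>Re e\<bar> powr p + \<bar>Im e\<bar> powr p)"
    using p by (intro powr_add_le) auto
  finally have "card I * norm e powr p \<le> card I * (2 powr p * (\<bar>Re e\<bar> powr p + \<bar>Im e\<bar> powr p))"
    by (intro mult_left_mono) auto
  also have "\<dots> = 2 powr p * (card I * \<bar>Re e\<bar> powr p + card I * \<bar>Im e\<bar> powr p)"
    by (simp add: algebra_simps)
  also have "\<dots> \<le> 2 powr p * (2 * ?S + 2 * ?S)"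
    using 1 2 by (intro mult_left_mono) auto
  finally show ?thesis by simp
qed

section \<open>Monomial actions\<close>

text \<open>
  A left action by monomial operators.  The permutations compose in the reverse order because they
  act on indices by substitution.
\<close>

locale monomial_action =
  fixes c :: "'g::group_add \<Rightarrow> nat \<Rightarrow> complex" and \<sigma> :: "'g \<Rightarrow> nat \<Rightarrow> nat"
  assumes norm_c: "norm (c g n) = 1"
    and c_add: "c (g + h) n = c g n * c h (\<sigma> g n)"
    and \<sigma>_add: "\<sigma> (g + h) n = \<sigma> h (\<sigma> g n)"
    and \<sigma>_zero: "\<sigma> 0 n = n"
begin

definition act :: "'g \<Rightarrow> (nat \<Rightarrow> complex) \<Rightarrow> nat \<Rightarrow> complex" where
  "act g f = (\<lambda>n. c g n * f (\<sigma> g n))"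

lemma act_add: "act (g + h) f = act g (act h f)"
  by (simp add: act_def c_add \<sigma>_add mult.assoc)

lemma act_diff: "act g (\<lambda>n. f n - k n) n = act g f n - act g k n"
  by (simp add: act_def right_diff_distrib)

lemma act_mazur: "act g (\<lambda>n. mazur \<theta> (f n)) n = mazur \<theta> (act g f n)"
  by (simp add: act_def mazur_unimodular norm_c)

lemma bij_\<sigma>: "bij (\<sigma> g)"
proof (rule o_bij)
  show "\<sigma> (- g) \<circ> \<sigma> g = id" using \<sigma>_add[of g "- g"] by (auto simp: \<sigma>_zero)
  show "\<sigma> g \<circ> \<sigma> (- g) = id" using \<sigma>_add[of "- g" g] by (auto simp: \<sigma>_zero)
qed

lemma lp_isometry_act: "lp_isometry p (act g)"
  unfolding act_def by (rule lp_isometry_monomial[OF bij_\<sigma> norm_c])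

lemma act_lp: "f \<in> lp p \<Longrightarrow> act g f \<in> lp p"
  using lp_isometry_act unfolding lp_isometry_def by (metis bij_betwE)

definition orbit :: "nat \<Rightarrow> nat set" where
  "orbit n = range (\<lambda>g. \<sigma> g n)"

lemma orbit_self: "n \<in> orbit n"
  unfolding orbit_def using \<sigma>_zero by (metis rangeI)

lemma orbit_eq:
  assumes "m \<in> orbit n"
  shows "orbit m = orbit n"
proof -
  obtain g where m: "m = \<sigma> g n" using assms by (auto simp: orbit_def)
  have "\<sigma> h m \<in> orbit n" for h
    unfolding orbit_def m \<sigma>_add[symmetric] by (rule rangeI)
  moreover have "\<sigma> h n = \<sigma> (- g + h) m" for h by (simp add: m \<sigma>_add[symmetric] add.assoc[symmetric])
  then have "\<sigma> h n \<in> orbit m" for h unfolding orbit_def by (metis rangeI)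
  ultimately show ?thesis by (auto simp: orbit_def)
qed

definition invariants :: "(nat \<Rightarrow> complex) set" where
  "invariants = {k. \<forall>g. act g k = k}"

lemma invariantD: "k \<in> invariants \<Longrightarrow> k n = c g n * k (\<sigma> g n)"
  unfolding invariants_def act_def mem_Collect_eq by metis

lemma invariants_cmult: "k \<in> invariants \<Longrightarrow> (\<lambda>n. a * k n) \<in> invariants"
  unfolding invariants_def act_def by (auto simp: fun_eq_iff)

lemma norm_invariant_orbit:
  assumes "k \<in> invariants" "m \<in> orbit n"
  shows "norm (k m) = norm (k n)"
proof -
  obtain g where "m = \<sigma> g n" using assms(2) by (auto simp: orbit_def)
  then show ?thesis
    using arg_cong[OF invariantD[OF assms(1), of n g], of norm] by (simp add: norm_mult norm_c)
qed

text \<open>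
  On a single orbit the invariants form a space of dimension at most 1.
\<close>

lemma invariants_ratio:
  assumes "u \<in> invariants" "k \<in> invariants" "m \<in> orbit n"
  shows "cnj (u m) * k m = cnj (u n) * k n"
proof -
  obtain g where m: "m = \<sigma> g n" using assms(3) by (auto simp: orbit_def)
  have cc: "cnj (c g n) * c g n = 1" using norm_c[of g n] complex_norm_square[of "c g n"] by (simp add: mult.commute)
  have "cnj (u n) * k n = (cnj (c g n) * c g n) * (cnj (u m) * k m)"
    using invariantD[OF assms(1), of n g] invariantD[OF assms(2), of n g] by (simp add: m)
  then show ?thesis by (simp add: cc)
qed

text \<open>
  An invariant \<open>k\<close> is controlled by its distance to \<open>\<phi>(f)\<close>, with a constant that depends on neither
  \<open>A\<close> nor \<open>k\<close>, so that the bounds for different orbits can be added up.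
\<close>

definition balanced :: "real \<Rightarrow> real \<Rightarrow> (nat \<Rightarrow> complex) \<Rightarrow> nat set \<Rightarrow> bool" where
  "balanced p \<theta> f A \<longleftrightarrow> (\<forall>k\<in>invariants. (\<Sum>m\<in>A. norm (k m) powr p)
     \<le> 4 * 2 powr p * (\<Sum>m\<in>A. norm (mazur \<theta> (f m) - k m) powr p))"

text \<open>
  If some invariant does not vanish on the orbit, scale it to a unimodular \<open>u\<close> and subtract from \<open>f\<close>
  the multiple of \<open>u\<close> whose coefficient is the coordinatewise median of \<open>cnj u * f\<close>.
\<close>

lemma balanced_translate_exists:
  assumes fin: "finite (orbit n)" and p: "0 \<le> p"
  shows "\<exists>v\<in>invariants. balanced p \<theta> (\<lambda>m. f m - v m) (orbit n)"
proof (cases "\<exists>u\<in>invariants. u n \<noteq> 0")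
  case False
  have zero: "k m = 0" if "k \<in> invariants" "m \<in> orbit n" for k m
    using norm_invariant_orbit[OF that] False that by auto
  have "balanced p \<theta> (\<lambda>m. f m - 0) (orbit n)"
    unfolding balanced_def
  proof
    fix k assume "k \<in> invariants"
    then have "(\<Sum>m\<in>orbit n. norm (k m) powr p) = 0"
      using zero by (intro sum.neutral) auto
    also have "\<dots> \<le> 4 * 2 powr p * (\<Sum>m\<in>orbit n. norm (mazur \<theta> (f m - 0) - k m) powr p)"
      by (intro mult_nonneg_nonneg sum_nonneg) auto
    finally show "(\<Sum>m\<in>orbit n. norm (k m) powr p)
        \<le> 4 * 2 powr p * (\<Sum>m\<in>orbit n. norm (mazur \<theta> (f m - 0) - k m) powr p)" .
  qed
  moreover have "(\<lambda>m. 0) \<in> invariants" by (simp add: invariants_def act_def)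
  ultimately show ?thesis by (intro bexI[where x = "\<lambda>m. 0"]) simp_all
next
  case True
  then obtain u0 where u0: "u0 \<in> invariants" "u0 n \<noteq> 0" by blast
  define u where "u = (\<lambda>m. (1 / of_real (norm (u0 n))) * u0 m)"
  have u: "u \<in> invariants" unfolding u_def by (rule invariants_cmult[OF u0(1)])
  have norm_u: "norm (u m) = 1" if "m \<in> orbit n" for m
    using norm_invariant_orbit[OF u0(1) that] u0(2) by (simp add: u_def norm_mult norm_divide)
  define w where "w m = cnj (u m) * f m" for m
  have ne: "orbit n \<noteq> {}" using orbit_self by blast
  obtain tr where tr: "card (orbit n) \<le> 2 * card {m\<in>orbit n. Re (w m) \<le> tr}"
    "card (orbit n) \<le> 2 * card {m\<in>orbit n. tr \<le> Re (w m)}"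
    by (rule median_exists[OF fin ne])
  obtain ti where ti: "card (orbit n) \<le> 2 * card {m\<in>orbit n. Im (w m) \<le> ti}"
    "card (orbit n) \<le> 2 * card {m\<in>orbit n. ti \<le> Im (w m)}"
    by (rule median_exists[OF fin ne])
  define v where "v = (\<lambda>m. Complex tr ti * u m)"
  have v: "v \<in> invariants" unfolding v_def by (rule invariants_cmult[OF u])
  have "balanced p \<theta> (\<lambda>m. f m - v m) (orbit n)"
    unfolding balanced_def
  proof
    fix k assume k: "k \<in> invariants"
    define e where "e = cnj (u n) * k n"
    define x where "x m = cnj (u m) * (f m - v m)" for m
    define y where "y m = cnj (u m) * mazur \<theta> (f m - v m)" for m
    have uu: "cnj (u m) * u m = 1" if "m \<in> orbit n" for m
      using norm_u[OF that] complex_norm_square[of "u m"] by (simp add: mult.commute)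
    have x: "x m = w m - Complex tr ti" if "m \<in> orbit n" for m
    proof -
      have "x m = w m - Complex tr ti * (cnj (u m) * u m)"
        by (simp add: x_def w_def v_def algebra_simps)
      then show ?thesis by (simp add: uu[OF that])
    qed
    have norm_y: "norm (y m - e) = norm (mazur \<theta> (f m - v m) - k m)" if "m \<in> orbit n" for m
    proof -
      have "y m - e = cnj (u m) * (mazur \<theta> (f m - v m) - k m)"
        using invariants_ratio[OF u k that] by (simp add: y_def e_def right_diff_distrib)
      then show ?thesis by (simp add: norm_mult norm_u[OF that])
    qed
    have norm_k: "norm (k m) = norm e" if "m \<in> orbit n" for m
      using norm_invariant_orbit[OF k that] norm_u[OF orbit_self] by (simp add: e_def norm_mult)
    have sets: "{m\<in>orbit n. Re (x m) \<le> 0} = {m\<in>orbit n. Re (w m) \<le> tr}"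
      "{m\<in>orbit n. 0 \<le> Re (x m)} = {m\<in>orbit n. tr \<le> Re (w m)}"
      "{m\<in>orbit n. Im (x m) \<le> 0} = {m\<in>orbit n. Im (w m) \<le> ti}"
      "{m\<in>orbit n. 0 \<le> Im (x m)} = {m\<in>orbit n. ti \<le> Im (w m)}"
      by (auto simp: x)
    have "card (orbit n) * norm e powr p \<le> 4 * 2 powr p * (\<Sum>m\<in>orbit n. norm (y m - e) powr p)"
    proof (rule complex_median_zero_bound[OF fin p])
      show "y m = of_real (norm (f m - v m) powr (\<theta> - 1)) * x m" for m
        by (simp add: y_def x_def mazur_def)
    qed (simp_all add: sets tr ti)
    then show "(\<Sum>m\<in>orbit n. norm (k m) powr p)
        \<le> 4 * 2 powr p * (\<Sum>m\<in>orbit n. norm (mazur \<theta> (f m - v m) - k m) powr p)"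
      by (simp add: norm_k norm_y)
  qed
  then show ?thesis using v by blast
qed

text \<open>
  Invariance is a condition on each orbit separately, so the translates chosen for the finite orbits
  can be glued.  On infinite orbits nothing is subtracted, which keeps the decay of \<open>f\<close> there.
\<close>

lemma balanced_translate_everywhere:
  assumes p: "0 \<le> p"
  obtains v where "v \<in> invariants" "\<And>n. infinite (orbit n) \<Longrightarrow> v n = 0"
    "\<And>n. finite (orbit n) \<Longrightarrow> balanced p \<theta> (\<lambda>m. f m - v m) (orbit n)"
proof -
  define V where "V A = (SOME v. v \<in> invariants \<and> balanced p \<theta> (\<lambda>m. f m - v m) A)" for A
  have V: "V (orbit n) \<in> invariants" "balanced p \<theta> (\<lambda>m. f m - V (orbit n) m) (orbit n)"
    if "finite (orbit n)" for n
  proof -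
    have "\<exists>v. v \<in> invariants \<and> balanced p \<theta> (\<lambda>m. f m - v m) (orbit n)"
      using balanced_translate_exists[OF that p, of \<theta> f] by blast
    from someI_ex[OF this] show "V (orbit n) \<in> invariants"
      "balanced p \<theta> (\<lambda>m. f m - V (orbit n) m) (orbit n)"
      unfolding V_def by auto
  qed
  define v where "v n = (if finite (orbit n) then V (orbit n) n else 0)" for n
  show thesis
  proof
    have "act g v n = v n" for g n
    proof -
      have "orbit (\<sigma> g n) = orbit n" by (rule orbit_eq) (auto simp: orbit_def)
      then show ?thesis using invariantD[OF V(1)[of n], of n g] by (simp add: act_def v_def)
    qed
    then show "v \<in> invariants" by (auto simp: invariants_def)
    show "v n = 0" if "infinite (orbit n)" for n using that by (simp add: v_def)
    show "balanced p \<theta> (\<lambda>m. f m - v m) (orbit n)" if "finite (orbit n)" for n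
    proof -
      have "v m = V (orbit n) m" if "m \<in> orbit n" for m
        using orbit_eq[OF that] \<open>finite (orbit n)\<close> by (simp add: v_def)
      then show ?thesis using V(2)[OF that] by (simp add: balanced_def)
    qed
  qed
qed

lemma invariant_vanishes_on_infinite_orbit:
  assumes k: "k \<in> invariants" and inf: "infinite (orbit n)"
    and lim: "h \<longlonglongrightarrow> 0" and eq: "\<And>m. m \<in> orbit n \<Longrightarrow> norm (k m) \<le> h m"
  shows "k n = 0"
proof (rule ccontr)
  assume "k n \<noteq> 0"
  then have "\<forall>\<^sub>F m in sequentially. h m < norm (k n)"
    using lim by (intro order_tendstoD) auto
  then obtain N where N: "\<And>m. N \<le> m \<Longrightarrow> h m < norm (k n)" by (auto simp: eventually_sequentially)
  obtain m where "m \<in> orbit n" "N \<le> m" using inf by (metis infinite_nat_iff_unbounded_le)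
  then show False using N[of m] eq[of m] norm_invariant_orbit[OF k, of m n] by simp
qed

lemma invariant_in_lp:
  assumes p: "0 < p" and h: "h \<in> lp p"
    and inf: "\<And>n. infinite (orbit n) \<Longrightarrow> k n = 0"
    and fin: "\<And>n. finite (orbit n) \<Longrightarrow>
      (\<Sum>m\<in>orbit n. norm (k m) powr p) \<le> C * (\<Sum>m\<in>orbit n. norm (h m) powr p)"
    and C: "0 \<le> C"
  shows "k \<in> lp p"
  unfolding lp_def mem_Collect_eq
proof (rule summableI_nonneg_bounded)
  fix N :: nat
  \<comment> \<open>The finite orbits meeting \<open>{..<N}\<close>; completing the partial sum to whole orbits only increases it.\<close>
  define Q where "Q = orbit ` {n. n < N \<and> finite (orbit n)}"
  have Q: "finite Q" "\<And>A. A \<in> Q \<Longrightarrow> finite A" by (auto simp: Q_def)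
  have disj: "\<forall>A\<in>Q. \<forall>B\<in>Q. A \<noteq> B \<longrightarrow> A \<inter> B = {}"
  proof (intro ballI impI)
    fix A B assume "A \<in> Q" "B \<in> Q" "A \<noteq> B"
    then obtain a b where "A = orbit a" "B = orbit b" by (auto simp: Q_def)
    then show "A \<inter> B = {}" using \<open>A \<noteq> B\<close> orbit_eq by blast
  qed
  have "(\<Sum>n<N. norm (k n) powr p) \<le> (\<Sum>n\<in>\<Union>Q. norm (k n) powr p)"
  proof -
    have "(\<Sum>n<N. norm (k n) powr p) = (\<Sum>n\<in>{..<N} \<inter> \<Union>Q. norm (k n) powr p)"
      using inf orbit_self by (intro sum.mono_neutral_right) (auto simp: Q_def)
    also have "\<dots> \<le> (\<Sum>n\<in>\<Union>Q. norm (k n) powr p)"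
      using Q by (intro sum_mono2) auto
    finally show ?thesis .
  qed
  also have "\<dots> = (\<Sum>A\<in>Q. \<Sum>n\<in>A. norm (k n) powr p)"
    using Q disj by (subst sum.Union_disjoint) auto
  also have "\<dots> \<le> (\<Sum>A\<in>Q. C * (\<Sum>n\<in>A. norm (h n) powr p))"
    using fin by (intro sum_mono) (auto simp: Q_def)
  also have "\<dots> = C * (\<Sum>n\<in>\<Union>Q. norm (h n) powr p)"
    using Q disj by (subst sum.Union_disjoint) (auto simp: sum_distrib_left)
  also have "\<dots> \<le> C * (\<Sum>n. norm (h n) powr p)"
    using h Q C by (intro mult_left_mono sum_le_suminf) (auto simp: lp_def)
  finally show "(\<Sum>n<N. norm (k n) powr p) \<le> C * (\<Sum>n. norm (h n) powr p)" .
qed simp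

text \<open>
  The invariant difference vanishes on infinite orbits by decay and is bounded by \<open>h\<close> on finite orbits
  by balancedness, so it lies in \<open>\<ell>\<^sub>p\<close>.
\<close>

lemma mazur_in_lp_of_invariant_diff:
  assumes p: "0 < p" and \<theta>: "0 < \<theta>"
    and f: "f \<longlonglongrightarrow> 0"
    and v: "\<And>n. infinite (orbit n) \<Longrightarrow> v n = 0"
      "\<And>n. finite (orbit n) \<Longrightarrow> balanced p \<theta> (\<lambda>m. f m - v m) (orbit n)"
    and h: "h \<in> lp p" and k: "(\<lambda>n. mazur \<theta> (f n - v n) - h n) \<in> invariants"
  shows "(\<lambda>n. mazur \<theta> (f n - v n)) \<in> lp p"
proof -
  define k where "k = (\<lambda>n. mazur \<theta> (f n - v n) - h n)"
  have k: "k \<in> invariants" using assms(7) by (simp add: k_def)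
  have "k \<in> lp p"
  proof (rule invariant_in_lp[OF p h])
    fix n assume inf: "infinite (orbit n)"
    \<comment> \<open>A null sequence that dominates the invariant \<open>k\<close>, whose modulus is constant on the orbit.\<close>
    have "(\<lambda>m. norm (f m) powr \<theta> + norm (h m)) \<longlonglongrightarrow> 0 powr \<theta> + 0"
      using \<theta> f lp_tendsto_0[OF p h]
      by (intro tendsto_add tendsto_powr2) (auto simp: tendsto_norm_zero_iff)
    then show "k n = 0"
    proof (intro invariant_vanishes_on_infinite_orbit[OF k inf])
      fix m assume "m \<in> orbit n"
      then have "v m = 0" using v(1)[of m] inf orbit_eq by simp
      then show "norm (k m) \<le> norm (f m) powr \<theta> + norm (h m)"
        using norm_triangle_ineq4[of "mazur \<theta> (f m)" "h m"] by (simp add: k_def norm_mazur)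
    qed simp
  next
    fix n assume "finite (orbit n)"
    then have "(\<Sum>m\<in>orbit n. norm (k m) powr p)
        \<le> 4 * 2 powr p * (\<Sum>m\<in>orbit n. norm (mazur \<theta> (f m - v m) - k m) powr p)"
      using v(2) k unfolding balanced_def by blast
    then show "(\<Sum>m\<in>orbit n. norm (k m) powr p)
        \<le> 4 * 2 powr p * (\<Sum>m\<in>orbit n. norm (h m) powr p)"
      by (simp add: k_def)
  qed simp
  then have "(\<lambda>n. k n + h n) \<in> lp p" using p h by (intro lp_add) auto
  then show ?thesis by (simp add: k_def)
qed

end

section \<open>From exponent p to a smaller exponent q\<close>

lemma orthogonal_rep_monomial:
  fixes \<pi> :: "'g::topological_group_add \<Rightarrow> (nat \<Rightarrow> complex) \<Rightarrow> nat \<Rightarrow> complex"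
  assumes q: "0 < q" "q \<noteq> 2" and \<pi>: "orthogonal_rep q \<pi>"
  obtains c \<sigma> where "monomial_action c \<sigma>"
    "\<And>g f. f \<in> lp q \<Longrightarrow> \<pi> g f = monomial_action.act c \<sigma> g f"
proof -
  have iso: "lp_isometry q (\<pi> g)" for g using \<pi> by (simp add: orthogonal_rep_def)
  have mult: "\<pi> (g + h) f = \<pi> g (\<pi> h f)" if "f \<in> lp q" for g h f
    using \<pi> that unfolding orthogonal_rep_def by metis
  have "\<forall>g. \<exists>cs. bij (snd cs) \<and> (\<forall>n. norm (fst cs n) = 1) \<and>
      (\<forall>f\<in>lp q. \<pi> g f = (\<lambda>n. fst cs n * f (snd cs n)))"
  proof
    fix g
    obtain c \<sigma> where "bij \<sigma>" "\<And>n. norm (c n) = 1" "\<And>f. f \<in> lp q \<Longrightarrow> \<pi> g f = (\<lambda>n. c n * f (\<sigma> n))"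
      using banach_lamperti[OF q iso[of g]] by metis
    then show "\<exists>cs. bij (snd cs) \<and> (\<forall>n. norm (fst cs n) = 1) \<and>
        (\<forall>f\<in>lp q. \<pi> g f = (\<lambda>n. fst cs n * f (snd cs n)))"
      by (intro exI[of _ "(c, \<sigma>)"]) auto
  qed
  then obtain cs where cs: "\<And>g. bij (snd (cs g))" "\<And>g n. norm (fst (cs g) n) = 1"
    "\<And>g f. f \<in> lp q \<Longrightarrow> \<pi> g f = (\<lambda>n. fst (cs g) n * f (snd (cs g) n))" by metis
  define c where "c g = fst (cs g)" for g
  define \<sigma> where "\<sigma> g = snd (cs g)" for g
  note cs = cs[folded c_def \<sigma>_def]
  have mem: "\<pi> g f \<in> lp q" if "f \<in> lp q" for g f
    using iso that unfolding lp_isometry_def by (metis bij_betwE)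
  have comp: "c (g + h) n * f (\<sigma> (g + h) n) = c g n * (c h (\<sigma> g n) * f (\<sigma> h (\<sigma> g n)))"
    if "f \<in> lp q" for g h n f
    using fun_cong[OF mult[OF that, of g h], of n] that cs(3)[of f] cs(3)[OF mem[OF that]] by simp
  have c0: "c g n \<noteq> 0" for g n using cs(2)[of g n] by auto
  \<comment> \<open>Testing on the unit sequence at \<open>\<sigma> h (\<sigma> g n)\<close> gives a nonzero value on the right.\<close>
  have \<sigma>_add: "\<sigma> (g + h) n = \<sigma> h (\<sigma> g n)" for g h n
    using comp[OF unit_seq_lp[of "\<sigma> h (\<sigma> g n)"], of g h n] c0 by (simp add: unit_seq_def split: if_splits)
  have c_add: "c (g + h) n = c g n * c h (\<sigma> g n)" for g h n
    using comp[OF unit_seq_lp[of "\<sigma> h (\<sigma> g n)"], of g h n] by (simp add: unit_seq_def \<sigma>_add)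
  have "\<sigma> 0 n = n" for n
    using \<sigma>_add[of 0 0 n] cs(1)[of 0] by (simp add: bij_def inj_eq)
  then interpret monomial_action c \<sigma>
    using c_add \<sigma>_add cs(2) by unfold_locales
  show thesis
    by (rule that[OF monomial_action_axioms]) (simp add: act_def cs(3))
qed

text \<open>
  Strong continuity is transported by the Mazur map: every \<open>h \<in> \<ell>\<^sub>p\<close> is the image of some \<open>f \<in> \<ell>\<^sub>q\<close>,
  and the increments of \<open>g \<mapsto> act g h\<close> are controlled by those of \<open>g \<mapsto> act g f\<close>.
\<close>

lemma orthogonal_rep_act:
  fixes c :: "'g::topological_group_add \<Rightarrow> nat \<Rightarrow> complex"
  assumes "monomial_action c \<sigma>" and pq: "0 < q" "q < p"
    and cont: "\<And>f. f \<in> lp q \<Longrightarrow> lp_continuous q (\<lambda>g. monomial_action.act c \<sigma> g f)"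
  shows "orthogonal_rep p (monomial_action.act c \<sigma>)"
proof -
  interpret monomial_action c \<sigma> by fact
  have "lp_continuous p (\<lambda>g. act g h)" if h: "h \<in> lp p" for h
  proof -
    define f where "f n = mazur (p / q) (h n)" for n
    have f: "f \<in> lp q" using h pq by (simp add: f_def lp_def norm_mazur powr_powr)
    have h_eq: "h = (\<lambda>n. mazur (q / p) (f n))"
      using mazur_mazur_inverse[of "q / p"] pq by (auto simp: f_def)
    show ?thesis
    proof (rule lp_continuous_dominated[OF _ _ _ cont[OF f]])
      show "(\<lambda>n. act g f n - act g' f n) \<in> lp q" for g g'
        using pq by (intro lp_diff act_lp f) auto
      show "norm (act g h n - act g' h n) powr p \<le> 3 powr p * norm (act g f n - act g' f n) powr q" for g g' n
        unfolding h_eq act_mazur by (rule mazur_holder_powr[OF pq])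
    qed (use pq in auto)
  qed
  then show ?thesis
    by (simp add: orthogonal_rep_def lp_isometry_act act_add)
qed

lemma property_F_lp_fixed_point:
  assumes "property_F_lp (G :: 'g::topological_group_add itself) p" "orthogonal_rep p \<pi>" "lp_cocycle p \<pi> (b :: 'g \<Rightarrow> _)"
  obtains f where "f \<in> lp p" "\<And>g. f = (\<lambda>n. \<pi> g f n + b g n)"
proof -
  have "affine_isometric_action p (\<lambda>g f n. \<pi> g f n + b g n)"
    unfolding affine_isometric_action_def using assms(2,3) by blast
  then have "\<exists>f\<in>lp p. \<forall>g. (\<lambda>n. \<pi> g f n + b g n) = f"
    using assms(1) unfolding property_F_lp_def by blast
  then obtain f where "f \<in> lp p" "\<forall>g. (\<lambda>n. \<pi> g f n + b g n) = f" by blast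
  then show thesis by (intro that[of f]) simp_all
qed

text \<open>
  The hypothesis on \<open>p\<close> is used twice, once for the given cocycle \<open>b\<close> and once for the coboundary \<open>B\<close>
  of the Mazur image of a normalised solution.
\<close>

lemma property_F_lp_decreasing:
  fixes G :: "'g::topological_group_add itself"
  assumes F: "property_F_lp G p" and q: "1 \<le> q" "q < p" "q \<noteq> 2"
  shows "property_F_lp G q"
  unfolding property_F_lp_def
proof (intro allI impI)
  fix \<alpha> :: "'g \<Rightarrow> (nat \<Rightarrow> complex) \<Rightarrow> nat \<Rightarrow> complex"
  assume "affine_isometric_action q \<alpha>"
  then obtain \<pi> b where \<pi>: "orthogonal_rep q \<pi>" and b: "lp_cocycle q \<pi> b"
    and \<alpha>: "\<And>g f. f \<in> lp q \<Longrightarrow> \<alpha> g f = (\<lambda>n. \<pi> g f n + b g n)"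
    unfolding affine_isometric_action_def by metis
  have pos: "0 < q" "0 < p" using q by auto
  obtain c \<sigma> where mono: "monomial_action c \<sigma>"
    and \<pi>_act: "\<And>g f. f \<in> lp q \<Longrightarrow> \<pi> g f = monomial_action.act c \<sigma> g f"
    using orthogonal_rep_monomial[OF pos(1) q(3) \<pi>] by blast
  interpret monomial_action c \<sigma> by fact
  have b_lp: "b g \<in> lp q" for g using b by (simp add: lp_cocycle_def)
  have b_diff: "(\<lambda>n. b g n - b g' n) \<in> lp q" for g g'
    using pos b_lp by (intro lp_diff) auto
  have b_cont: "lp_continuous q b" using b by (simp add: lp_cocycle_def)
  have b_add: "b (g + h) = (\<lambda>n. b g n + act g (b h) n)" for g h
    using b \<pi>_act[OF b_lp] by (simp add: lp_cocycle_def)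
  have rep: "orthogonal_rep p act"
  proof (rule orthogonal_rep_act[OF mono pos(1) q(2)])
    fix f assume f: "f \<in> lp q"
    then have "lp_continuous q (\<lambda>g. \<pi> g f)" using \<pi> by (simp add: orthogonal_rep_def)
    then show "lp_continuous q (\<lambda>g. act g f)" using \<pi>_act[OF f] by simp
  qed
  have "lp_cocycle p act b"
    unfolding lp_cocycle_def
    using lp_subset(1)[OF pos(1) _ b_lp, of p] lp_continuous_mono[OF pos(1) _ b_cont b_diff, of p] q(2) b_add
    by simp
  then obtain f where f: "f \<in> lp p" "\<And>g. f = (\<lambda>n. act g f n + b g n)"
    using property_F_lp_fixed_point[OF F rep] by metis
  define \<theta> where "\<theta> = q / p"
  have \<theta>: "0 < \<theta>" using pos by (simp add: \<theta>_def)
  obtain v where v: "v \<in> invariants" "\<And>n. infinite (orbit n) \<Longrightarrow> v n = 0"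
    "\<And>n. finite (orbit n) \<Longrightarrow> balanced p \<theta> (\<lambda>m. f m - v m) (orbit n)"
    using balanced_translate_everywhere[of p \<theta> f] pos by (metis less_imp_le)
  define f' where "f' = (\<lambda>n. f n - v n)"
  have f'_fixed: "f' n = act g f' n + b g n" for g n
  proof -
    have "act g v = v" using v(1) by (simp add: invariants_def)
    then show ?thesis using fun_cong[OF f(2)[of g], of n] by (simp add: f'_def act_diff)
  qed
  define \<Phi> where "\<Phi> = (\<lambda>n. mazur \<theta> (f' n))"
  have act_\<Phi>: "act g \<Phi> n = mazur \<theta> (act g f' n)" for g n
    unfolding \<Phi>_def by (rule act_mazur)
  define B where "B g n = \<Phi> n - act g \<Phi> n" for g n
  have B_diff: "norm (B g n - B g' n) powr p \<le> 3 powr p * norm (b g n - b g' n) powr q" for g g' n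
  proof -
    have "B g n - B g' n = mazur \<theta> (act g' f' n) - mazur \<theta> (act g f' n)"
      by (simp add: B_def act_\<Phi>)
    moreover have "act g' f' n - act g f' n = b g n - b g' n"
      using f'_fixed[of n g] f'_fixed[of n g'] by (simp add: algebra_simps)
    ultimately show ?thesis using mazur_holder_powr[OF pos(1) q(2)] by (metis \<theta>_def)
  qed
  \<comment> \<open>Since \<open>b 0\<close> and \<open>B 0\<close> vanish, the increment bound with \<open>g' = 0\<close> bounds \<open>B g\<close> itself.\<close>
  have b0: "b 0 = (\<lambda>n. 0)" and B0: "B 0 = (\<lambda>n. 0)"
  proof -
    have act0: "act 0 h = h" for h
    proof
      fix n
      have "c 0 n \<noteq> 0" using norm_c[of 0 n] by auto
      then have "c 0 n = 1" using c_add[of 0 0 n] by (simp add: \<sigma>_zero)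
      then show "act 0 h n = h n" by (simp add: act_def \<sigma>_zero)
    qed
    show "b 0 = (\<lambda>n. 0)" using f'_fixed[of _ 0] by (simp add: act0 fun_eq_iff)
    show "B 0 = (\<lambda>n. 0)" by (simp add: B_def act0 fun_eq_iff)
  qed
  have "lp_cocycle p act B"
    unfolding lp_cocycle_def
  proof (intro conjI allI)
    show "B g \<in> lp p" for g
      using lp_dominated(1)[OF pos(2,1) b_lp[of g], of "B g" "3 powr p"] B_diff[of g _ 0] by (simp add: b0 B0)
    show "lp_continuous p B"
      by (rule lp_continuous_dominated[OF pos(2,1) _ b_cont b_diff B_diff]) simp
    show "B (g + h) = (\<lambda>n. B g n + act g (B h) n)" for g h
    proof
      fix n
      have "B h = (\<lambda>n. \<Phi> n - act h \<Phi> n)" by (simp add: B_def fun_eq_iff)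
      then show "B (g + h) n = B g n + act g (B h) n" by (simp add: B_def act_add act_diff)
    qed
  qed
  then obtain h where h: "h \<in> lp p" "\<And>g. h = (\<lambda>n. act g h n + B g n)"
    using property_F_lp_fixed_point[OF F rep] by metis
  have "act g (\<lambda>n. \<Phi> n - h n) n = \<Phi> n - h n" for g n
    using fun_cong[OF h(2)[of g], of n] by (simp add: act_diff B_def algebra_simps)
  then have "(\<lambda>n. \<Phi> n - h n) \<in> invariants" by (simp add: invariants_def fun_eq_iff)
  then have "\<Phi> \<in> lp p"
    using mazur_in_lp_of_invariant_diff[OF pos(2) \<theta> lp_tendsto_0[OF pos(2) f(1)] v(2,3) h(1)]
    by (simp add: \<Phi>_def f'_def)
  then have f': "f' \<in> lp q"
    using pos by (simp add: lp_def \<Phi>_def norm_mazur powr_powr \<theta>_def)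
  show "\<exists>f\<in>lp q. \<forall>g. \<alpha> g f = f"
  proof (intro bexI[OF _ f'] allI)
    show "\<alpha> g f' = f'" for g
      using f'_fixed by (simp add: \<alpha>[OF f'] \<pi>_act[OF f'] fun_eq_iff)
  qed
qed

section \<open>The shape of the fixed-point spectrum\<close>

lemma decreasing_interval_cases:
  fixes S :: "real set"
  assumes ge: "\<And>p. p \<in> S \<Longrightarrow> 1 \<le> p"
    and down: "\<And>p q. p \<in> S \<Longrightarrow> 1 \<le> q \<Longrightarrow> q \<le> p \<Longrightarrow> q \<in> S"
    and ne: "S \<noteq> {}"
  shows "(\<exists>p\<^sub>c::ereal. 1 < p\<^sub>c \<and> S = {p. 1 \<le> p \<and> ereal p < p\<^sub>c}) \<or> (\<exists>p\<^sub>c. 1 \<le> p\<^sub>c \<and> S = {1..p\<^sub>c})"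
proof (cases "bdd_above S")
  case False
  then have "\<exists>p\<in>S. q \<le> p" for q by (meson bdd_above.I linear)
  then have "q \<in> S" if "1 \<le> q" for q using down that by blast
  then have "S = {p. 1 \<le> p \<and> ereal p < \<infinity>}" using ge by auto
  moreover have "1 < (\<infinity> :: ereal)" by simp
  ultimately show ?thesis by blast
next
  case True
  define s where "s = Sup S"
  have up: "p \<le> s" if "p \<in> S" for p using cSup_upper[OF that True] by (simp add: s_def)
  have low: "q \<in> S" if "1 \<le> q" "q < s" for q
    using less_cSupD[OF ne, of q] down that by (auto simp: s_def intro: less_imp_le)
  show ?thesis
  proof (cases "s \<in> S")
    case True
    then have "S = {1..s}" using up ge down[OF True] unfolding atLeastAtMost_def atLeast_def atMost_def by blast
    then show ?thesis using ge[OF True] by blast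
  next
    case False
    then have "p < s" if "p \<in> S" for p using up[OF that] that by (cases "p = s") auto
    then have "S = {p. 1 \<le> p \<and> ereal p < ereal s}" using low ge unfolding less_ereal.simps(1) by blast
    moreover have "1 < ereal s"
    proof -
      obtain p where "p \<in> S" using ne by blast
      then have "1 \<le> p" "p < s" using ge \<open>\<And>p. p \<in> S \<Longrightarrow> p < s\<close> by blast+
      then show ?thesis by simp
    qed
    ultimately show ?thesis by blast
  qed
qed

text \<open>
  If 2 is a gap below an element of \<open>S\<close>, filling it yields an interval to which the case without gap
  applies.
\<close>

lemma decreasing_off_point_cases:
  fixes S :: "real set"
  assumes ge: "\<And>p. p \<in> S \<Longrightarrow> 1 \<le> p"
    and down: "\<And>p q. p \<in> S \<Longrightarrow> 1 \<le> q \<Longrightarrow> q < p \<Longrightarrow> q \<noteq> 2 \<Longrightarrow> q \<in> S"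
  shows "S = {} \<or>
     (\<exists>p\<^sub>c::ereal. 1 < p\<^sub>c \<and> p\<^sub>c \<le> \<infinity> \<and> S = {p. 1 \<le> p \<and> ereal p < p\<^sub>c}) \<or>
     (\<exists>p\<^sub>c::real. 1 \<le> p\<^sub>c \<and> S = {1..p\<^sub>c}) \<or>
     (\<exists>p\<^sub>c::ereal. 2 < p\<^sub>c \<and> p\<^sub>c \<le> \<infinity> \<and> S = {p. 1 \<le> p \<and> ereal p < p\<^sub>c} - {2}) \<or>
     (\<exists>p\<^sub>c::real. 2 < p\<^sub>c \<and> S = {1..p\<^sub>c} - {2})"
proof (cases "2 \<notin> S \<and> (\<exists>p\<in>S. 2 < p)")
  case True
  then obtain p0 where p0: "p0 \<in> S" "2 < p0" and 2: "2 \<notin> S" by blast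
  have eq: "S = insert 2 S - {2}" using 2 by auto
  have "(\<exists>p\<^sub>c::ereal. 1 < p\<^sub>c \<and> insert 2 S = {p. 1 \<le> p \<and> ereal p < p\<^sub>c}) \<or>
      (\<exists>p\<^sub>c. 1 \<le> p\<^sub>c \<and> insert 2 S = {1..p\<^sub>c})"
  proof (rule decreasing_interval_cases)
    fix p q :: real assume pq: "p \<in> insert 2 S" "1 \<le> q" "q \<le> p"
    show "q \<in> insert 2 S"
    proof (cases "q = 2 \<or> q = p")
      case False
      then have "q < max p p0" "max p p0 \<in> S" using pq p0 by (auto simp: max_def)
      then show ?thesis using down False pq by blast
    qed (use pq in auto)
  qed (use ge in auto)
  then show ?thesis
  proof (elim disjE exE conjE)
    fix p\<^sub>c :: ereal assume *: "insert 2 S = {p. 1 \<le> p \<and> ereal p < p\<^sub>c}"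
    then have "ereal 2 < p\<^sub>c" by blast
    then have "2 < p\<^sub>c" by simp
    moreover have "S = {p. 1 \<le> p \<and> ereal p < p\<^sub>c} - {2}" using eq unfolding * .
    moreover have "p\<^sub>c \<le> \<infinity>" by simp
    ultimately show ?thesis by blast
  next
    fix p\<^sub>c :: real assume *: "insert 2 S = {1..p\<^sub>c}"
    then have "p0 \<in> {1..p\<^sub>c}" using p0 by blast
    then have "2 < p\<^sub>c" using p0 by simp
    moreover have "S = {1..p\<^sub>c} - {2}" using eq unfolding * .
    ultimately show ?thesis by blast
  qed
next
  case no_gap: False
  have "q \<in> S" if "p \<in> S" "1 \<le> q" "q \<le> p" for p q
  proof (cases "q = p \<or> q \<noteq> 2")
    case True
    then show ?thesis using down[OF that(1,2)] that by fastforce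
  next
    case False
    then show ?thesis using no_gap that by (metis less_le)
  qed
  then have "(\<exists>p\<^sub>c::ereal. 1 < p\<^sub>c \<and> S = {p. 1 \<le> p \<and> ereal p < p\<^sub>c}) \<or> (\<exists>p\<^sub>c. 1 \<le> p\<^sub>c \<and> S = {1..p\<^sub>c})"
    if "S \<noteq> {}" using decreasing_interval_cases[OF ge _ that] by blast
  moreover have "x \<le> \<infinity>" for x :: ereal by simp
  ultimately show ?thesis by blast
qed

theorem theorem2:
  fixes G :: "'g::{topological_group_add, second_countable_topology, t2_space} itself"
  assumes "locally_compact_space (euclidean :: 'g topology)"
  shows "F_lp_exponents G = {} \<or>
         (\<exists>p\<^sub>c::ereal. 1 < p\<^sub>c \<and> p\<^sub>c \<le> \<infinity> \<and>
            F_lp_exponents G = {p. 1 \<le> p \<and> ereal p < p\<^sub>c}) \<or>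
         (\<exists>p\<^sub>c::real. 1 \<le> p\<^sub>c \<and> F_lp_exponents G = {1..p\<^sub>c}) \<or>
         (\<exists>p\<^sub>c::ereal. 2 < p\<^sub>c \<and> p\<^sub>c \<le> \<infinity> \<and>
            F_lp_exponents G = {p. 1 \<le> p \<and> ereal p < p\<^sub>c} - {2}) \<or>
         (\<exists>p\<^sub>c::real. 2 < p\<^sub>c \<and> F_lp_exponents G = {1..p\<^sub>c} - {2})"
proof (rule decreasing_off_point_cases)
  show "1 \<le> p" if "p \<in> F_lp_exponents G" for p
    using that by (simp add: F_lp_exponents_def)
  show "q \<in> F_lp_exponents G" if "p \<in> F_lp_exponents G" "1 \<le> q" "q < p" "q \<noteq> 2" for p q
    using that property_F_lp_decreasing[of G p q] by (simp add: F_lp_exponents_def)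
qed

end
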